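(* Let $(X,\tau,\le)$ be a separable linearly ordered topological space, let $\mu$ be a probability measure on the Borel $\sigma$-algebra of $(X,\tau)$, and let $F:X\to[0,1]$, $F(x)=\mu(\{y\in X: y\le x\})$, be its cumulative distribution function. Then: (1) $F$ is monotonically non-decreasing. (2) $F$ is right $\tau$-continuous. (3) If $X$ has no minimum, then $\inf F(X)=0$. (4) $\sup F(X)=1$.
   Context: A linearly ordered topological space (LOTS) is a triple $(X,\tau,\le)$ where $\le$ is a linear order on $X$ and $\tau$ is the order topology, i.e. the topology with subbasis $\{\{x\in X:x<a\}:a\in X\}\cup\{\{x\in X:x>a\}:a\in X\}$. Separable means having a countable $\tau$-dense subset. A sequence $(x_n)$ in $X$ is right $\tau$-convergent to $x$ if $x_n\to x$ in $\tau$ and $x_n\ge x$ for all $n$. A function $f:X\to[0,1]$ is right $\tau$-continuous if for every $x\in X$ and every sequence $(x_n)$ right $\tau$-convergent to $x$ one has $f(x_n)\to f(x)$. *)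

theory Defs
  imports "HOL-Probability.Probability"
begin

text \<open>
  A linearly ordered topological space is a type of class
  \<^class>\<open>linorder_topology\<close>: a linear order whose open sets are generated by
  the open rays. Separability is \<^const>\<open>separable_space\<close> of its
  \<^const>\<open>euclidean\<close> topology.
\<close>

definition right_convergent_to :: "(nat \<Rightarrow> 'a::linorder_topology) \<Rightarrow> 'a \<Rightarrow> bool" where
  "right_convergent_to s x \<longleftrightarrow> s \<longlonglongrightarrow> x \<and> (\<forall>n. x \<le> s n)"

text \<open>
  This is a condition on sequences only; \<^class>\<open>linorder_topology\<close> does not include
  first countability, so it is not expressed by a limit along \<^const>\<open>at_right\<close>.
\<close>

definition right_seq_continuous :: "('a::linorder_topology \<Rightarrow> real) \<Rightarrow> bool" where
  "right_seq_continuous f \<longleftrightarrow>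
     (\<forall>x s. right_convergent_to s x \<longrightarrow> (\<lambda>n. f (s n)) \<longlonglongrightarrow> f x)"

text \<open>The library's \<^const>\<open>cdf\<close> is restricted to measures on the real line.\<close>

definition lots_cdf :: "'a::linorder_topology measure \<Rightarrow> 'a \<Rightarrow> real" where
  "lots_cdf \<mu> x = measure \<mu> {y. y \<le> x}"

text \<open>
  The distribution function of a probability measure takes values in the unit interval, so
  infima and suprema of its range taken in the reals agree with those taken there.
\<close>

lemma lots_cdf_in_unit_interval:
  assumes "prob_space \<mu>"
  shows "lots_cdf \<mu> x \<in> {0..1}"
  using assms by (simp add: lots_cdf_def prob_space.prob_le_1)

end

theory Submission
  imports Defs
begin

text \<open>
  Monotonicity is monotonicity of \<open>\<mu>\<close>. The other three claims evaluate a limit of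
  \<open>\<mu> {..s n}\<close> along a suitable sequence \<open>s\<close>. In each case every single point is eventually
  inside or eventually outside the segments \<open>{..s n}\<close>; so their indicators converge pointwise,
  and dominated convergence gives convergence of the measures (\<open>lots_cdf_tendsto\<close>). Since the
  segments may vary non-monotonically with \<open>n\<close>, this applies directly to an arbitrary right
  convergent sequence.

  Separability supplies the sequences for the two ends of \<open>X\<close>. If there is no least element,
  every open ray \<open>{..<z}\<close> is nonempty and so meets a countable dense set, and the running
  minima of an enumeration of that set go below every point: their initial segments shrink to
  the empty set. Dually, without a greatest element the running maxima exhaust \<open>X\<close>; a greatest
  element, if there is one, does so at once, as a constant sequence.
\<close>

text \<open>
  The hypothesis on \<open>s\<close> is pointwise convergence of the indicators of \<open>{..s n}\<close> to that of \<open>A\<close>.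
  The limit set is arbitrary because it is an initial segment \<open>{..x}\<close> for right continuity, but
  \<open>{}\<close> and \<open>UNIV\<close> at the two ends of the order.
\<close>
lemma lots_cdf_tendsto:
  fixes \<mu> :: "'a::linorder_topology measure"
  assumes "sets \<mu> = sets borel" and "prob_space \<mu>"
    and A: "A \<in> sets borel"
    and ev: "\<And>z. \<forall>\<^sub>F n in sequentially. z \<le> s n \<longleftrightarrow> z \<in> A"
  shows "(\<lambda>n. lots_cdf \<mu> (s n)) \<longlonglongrightarrow> measure \<mu> A"
proof -
  interpret prob_space \<mu> by fact
  have [measurable]: "A \<in> sets \<mu>" "\<And>x. {..x} \<in> sets \<mu>"
    using A \<open>sets \<mu> = sets borel\<close> by auto
  have "(\<lambda>n. LINT z|\<mu>. indicator {..s n} z :: real) \<longlonglongrightarrow> (LINT z|\<mu>. indicator A z)"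
  proof (rule integral_dominated_convergence[where w = "\<lambda>_. 1"])
    show "AE z in \<mu>. (\<lambda>n. indicator {..s n} z :: real) \<longlonglongrightarrow> indicator A z"
    proof (rule AE_I2)
      fix z
      show "(\<lambda>n. indicator {..s n} z :: real) \<longlonglongrightarrow> indicator A z"
        by (rule tendsto_eventually, rule eventually_mono[OF ev[of z]])
           (simp add: indicator_def)
    qed
  qed (auto simp: indicator_def)
  then show ?thesis
    using sets_eq_imp_space_eq[OF \<open>sets \<mu> = sets borel\<close>]
    by (simp add: lots_cdf_def atMost_def)
qed

lemma mono_lots_cdf:
  fixes \<mu> :: "'a::linorder_topology measure"
  assumes "sets \<mu> = sets borel" and "prob_space \<mu>"
  shows "mono (lots_cdf \<mu>)"
proof (rule monoI)
  interpret prob_space \<mu> by fact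
  fix x y :: 'a assume "x \<le> y"
  then have "measure \<mu> {..x} \<le> measure \<mu> {..y}"
    using assms(1) by (intro finite_measure_mono) auto
  then show "lots_cdf \<mu> x \<le> lots_cdf \<mu> y"
    by (simp add: lots_cdf_def atMost_def)
qed

text \<open>
  A point \<open>z \<le> x\<close> lies below all \<open>s n\<close>, since these are at least \<open>x\<close>. A point \<open>z > x\<close> is
  eventually not below \<open>s n\<close>, since \<open>{..<z}\<close> is a neighbourhood of \<open>x\<close>.
\<close>
lemma right_seq_continuous_lots_cdf:
  fixes \<mu> :: "'a::linorder_topology measure"
  assumes "sets \<mu> = sets borel" and "prob_space \<mu>"
  shows "right_seq_continuous (lots_cdf \<mu>)"
  unfolding right_seq_continuous_def
proof (intro allI impI)
  fix x and s :: "nat \<Rightarrow> 'a" assume "right_convergent_to s x"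
  then have lim: "s \<longlonglongrightarrow> x" and ge: "\<And>n. x \<le> s n"
    by (auto simp: right_convergent_to_def)
  have "(\<lambda>n. lots_cdf \<mu> (s n)) \<longlonglongrightarrow> measure \<mu> {..x}"
  proof (rule lots_cdf_tendsto[OF assms])
    fix z :: 'a
    show "\<forall>\<^sub>F n in sequentially. z \<le> s n \<longleftrightarrow> z \<in> {..x}"
    proof (cases "z \<le> x")
      case True
      then show ?thesis using ge by (auto intro: always_eventually order_trans)
    next
      case False
      then show ?thesis
        using order_tendstoD(2)[OF lim, of z] by (simp add: not_le[symmetric])
    qed
  qed simp
  then show "(\<lambda>n. lots_cdf \<mu> (s n)) \<longlonglongrightarrow> lots_cdf \<mu> x"
    by (simp add: lots_cdf_def atMost_def)
qed

lemma separable_space_dense_sequence: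
  assumes "separable_space (euclidean :: 'a::topological_space topology)"
  obtains d :: "nat \<Rightarrow> 'a::topological_space" where "\<And>U. open U \<Longrightarrow> U \<noteq> {} \<Longrightarrow> \<exists>n. d n \<in> U"
proof -
  obtain D :: "'a set" where D: "countable D" "closure D = UNIV"
    using assms unfolding separable_space_def by auto
  then have "D \<noteq> {}" by auto
  show ?thesis
  proof (rule that)
    fix U :: "'a set" assume "open U" "U \<noteq> {}"
    then have "U \<inter> D \<noteq> {}"
      using D(2) open_Int_closure_eq_empty[of U D] by simp
    then show "\<exists>n. from_nat_into D n \<in> U"
      using from_nat_into_surj[OF D(1)] by blast
  qed
qed

lemma separable_coinitial_sequence:
  assumes "separable_space (euclidean :: 'a::linorder_topology topology)"
    and no_min: "\<nexists>m::'a. \<forall>x. m \<le> x"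
  obtains s :: "nat \<Rightarrow> 'a::linorder_topology" where "\<And>z. \<forall>\<^sub>F n in sequentially. s n < z"
proof -
  obtain d :: "nat \<Rightarrow> 'a" where d: "\<And>U. open U \<Longrightarrow> U \<noteq> {} \<Longrightarrow> \<exists>n. d n \<in> U"
    using separable_space_dense_sequence[OF assms(1)] by blast
  show ?thesis
  proof (rule that)
    fix z :: 'a
    obtain y where "y < z" using no_min by (meson not_le)
    then have "{..<z} \<noteq> {}" by blast
    then obtain k where "d k < z" using d[of "{..<z}"] by auto
    then have "Min (d ` {..n}) < z" if "n \<ge> k" for n
      using that by (subst Min_less_iff) auto
    then show "\<forall>\<^sub>F n in sequentially. Min (d ` {..n}) < z"
      by (auto simp: eventually_sequentially)
  qed
qed

lemma separable_cofinal_sequence: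
  assumes "separable_space (euclidean :: 'a::linorder_topology topology)"
  obtains s :: "nat \<Rightarrow> 'a::linorder_topology" where "\<And>z. \<forall>\<^sub>F n in sequentially. z \<le> s n"
proof (cases "\<exists>m::'a. \<forall>x. x \<le> m")
  case True
  then obtain m :: 'a where "\<forall>x. x \<le> m" by blast
  then show ?thesis by (intro that[of "\<lambda>_. m"]) simp
next
  case False
  obtain d :: "nat \<Rightarrow> 'a" where d: "\<And>U. open U \<Longrightarrow> U \<noteq> {} \<Longrightarrow> \<exists>n. d n \<in> U"
    using separable_space_dense_sequence[OF assms] by blast
  show ?thesis
  proof (rule that)
    fix z :: 'a
    obtain y where "z < y" using False by (meson not_le)
    then have "{z<..} \<noteq> {}" by blast
    then obtain k where "z < d k" using d[of "{z<..}"] by auto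
    then have "z \<le> Max (d ` {..n})" if "n \<ge> k" for n
      using that by (subst Max_ge_iff) (auto intro: less_imp_le)
    then show "\<forall>\<^sub>F n in sequentially. z \<le> Max (d ` {..n})"
      by (auto simp: eventually_sequentially)
  qed
qed

lemma INF_lots_cdf_eq_0:
  fixes \<mu> :: "'a::linorder_topology measure"
  assumes "separable_space (euclidean :: 'a topology)"
    and "sets \<mu> = sets borel" and "prob_space \<mu>"
    and "\<nexists>m::'a. \<forall>x. m \<le> x"
  shows "(INF x. lots_cdf \<mu> x) = 0"
proof (rule antisym)
  note bounds = lots_cdf_in_unit_interval[OF assms(3)]
  obtain s :: "nat \<Rightarrow> 'a" where s: "\<And>z. \<forall>\<^sub>F n in sequentially. s n < z"
    using separable_coinitial_sequence[OF assms(1,4)] by blast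
  have "(\<lambda>n. lots_cdf \<mu> (s n)) \<longlonglongrightarrow> measure \<mu> {}"
    by (rule lots_cdf_tendsto[OF assms(2,3)])
       (auto simp: not_le s)
  moreover have "(INF x. lots_cdf \<mu> x) \<le> lots_cdf \<mu> (s n)" for n
    using bounds by (intro cINF_lower bdd_belowI[of _ 0]) auto
  ultimately show "(INF x. lots_cdf \<mu> x) \<le> 0"
    by (auto intro: LIMSEQ_le_const)
  show "0 \<le> (INF x. lots_cdf \<mu> x)"
    using bounds by (intro cINF_greatest) auto
qed

lemma SUP_lots_cdf_eq_1:
  fixes \<mu> :: "'a::linorder_topology measure"
  assumes "separable_space (euclidean :: 'a topology)"
    and "sets \<mu> = sets borel" and "prob_space \<mu>"
  shows "(SUP x. lots_cdf \<mu> x) = 1"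
proof (rule antisym)
  note bounds = lots_cdf_in_unit_interval[OF assms(3)]
  obtain s :: "nat \<Rightarrow> 'a" where s: "\<And>z. \<forall>\<^sub>F n in sequentially. z \<le> s n"
    using separable_cofinal_sequence[OF assms(1)] by blast
  have "measure \<mu> UNIV = 1"
    using prob_space.prob_space[OF assms(3)] sets_eq_imp_space_eq[OF assms(2)] by simp
  moreover have "(\<lambda>n. lots_cdf \<mu> (s n)) \<longlonglongrightarrow> measure \<mu> UNIV"
    by (rule lots_cdf_tendsto[OF assms(2,3)]) (auto simp: s)
  moreover have "lots_cdf \<mu> (s n) \<le> (SUP x. lots_cdf \<mu> x)" for n
    using bounds by (intro cSUP_upper bdd_aboveI[of _ 1]) auto
  ultimately show "1 \<le> (SUP x. lots_cdf \<mu> x)"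
    by (auto intro: LIMSEQ_le_const2)
  show "(SUP x. lots_cdf \<mu> x) \<le> 1"
    using bounds by (intro cSUP_least) auto
qed

theorem proposition4p6:
  fixes \<mu> :: "'a::linorder_topology measure"
    and F :: "'a \<Rightarrow> real"
  assumes "separable_space (euclidean :: 'a topology)"
    and "sets \<mu> = sets borel"
    and "prob_space \<mu>"
    and "F = lots_cdf \<mu>"
  shows "mono F
    \<and> right_seq_continuous F
    \<and> ((\<nexists>m::'a. \<forall>x. m \<le> x) \<longrightarrow> (INF x. F x) = 0)
    \<and> (SUP x. F x) = 1"
  unfolding assms(4)
  using mono_lots_cdf[OF assms(2,3)] right_seq_continuous_lots_cdf[OF assms(2,3)]
    INF_lots_cdf_eq_0[OF assms(1-3)] SUP_lots_cdf_eq_1[OF assms(1-3)]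
  by blast

end
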